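(* The following are true. (1) If $\ell$ is an odd prime and $0\le a_1,a_2<\ell$ satisfy $\left(\frac{-16a_1+8a_2+1}{\ell}\right)=-1$, then for every non-negative integer $n$ we have $p_2(a_1,\ell;\ell n+a_2)=0$. (2) If $\ell\equiv2\pmod3$ is prime and $0\le a_1,a_2<\ell^2$ satisfy $\mathrm{ord}_\ell(-9a_1+3a_2+1)=1$, then for every non-negative integer $n$ we have $p_3(a_1,\ell^2;\ell^2n+a_2)=0$.
   Context: For a partition $\lambda$, each cell of its Young diagram has a hook number: the number of cells directly to its right in its row plus the number of cells directly below it in its column, plus one for the cell itself. $\mathcal H_t(\lambda)$ is the multiset of hook numbers of $\lambda$ divisible by $t$, and $p_t(a,b;n)=\#\{\lambda\vdash n:\#\mathcal H_t(\lambda)\equiv a\pmod b\}$. $\left(\frac\cdot\ell\right)$ is the Legendre symbol and $\mathrm{ord}_\ell(m)$ is the exponent of $\ell$ in $m$. *)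

theory Defs
  imports "HOL-Number_Theory.Number_Theory" "HOL-Library.Multiset"
begin

text \<open>A partition is the list of its parts, in weakly decreasing order and all positive.\<close>

definition partitions :: "nat \<Rightarrow> nat list set" where
  "partitions n = {xs. sorted_wrt (\<ge>) xs \<and> 0 \<notin> set xs \<and> sum_list xs = n}"

text \<open>English convention, with rows and columns numbered from 0: the cell \<open>(i, j)\<close> is in row \<open>i\<close>,
  counted from the top, and in column \<open>j\<close>, counted from the left.\<close>

definition young_diagram :: "nat list \<Rightarrow> (nat \<times> nat) set" where
  "young_diagram xs = {(i, j). i < length xs \<and> j < xs ! i}"

definition hook_number :: "nat list \<Rightarrow> nat \<times> nat \<Rightarrow> nat" where
  "hook_number xs = (\<lambda>(i, j).
     card {(i', j') \<in> young_diagram xs. i' = i \<and> j < j'}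
   + card {(i', j') \<in> young_diagram xs. i < i' \<and> j' = j} + 1)"

definition hook_multiset :: "nat \<Rightarrow> nat list \<Rightarrow> nat multiset" where
  "hook_multiset t xs =
     filter_mset (\<lambda>h. t dvd h) (image_mset (hook_number xs) (mset_set (young_diagram xs)))"

text \<open>The function \<open>p\<^sub>t(a, b; n)\<close>.\<close>

definition hook_count :: "nat \<Rightarrow> nat \<Rightarrow> nat \<Rightarrow> nat \<Rightarrow> nat" where
  "hook_count t a b n = card {xs \<in> partitions n. [size (hook_multiset t xs) = a] (mod b)}"

text \<open>The sets involved are finite, so that \<open>mset_set\<close> and \<open>card\<close> do not fall back to their
  default values for infinite sets.\<close>

lemma finite_young_diagram: "finite (young_diagram xs)"
proof -
  have "young_diagram xs = Sigma {..<length xs} (\<lambda>i. {..<xs ! i})"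
    by (auto simp: young_diagram_def)
  then show ?thesis by simp
qed

lemma length_le_sum_list: "0 \<notin> set xs \<Longrightarrow> length xs \<le> sum_list (xs :: nat list)"
  by (induction xs) auto

lemma finite_partitions: "finite (partitions n)"
proof (rule finite_subset)
  show "partitions n \<subseteq> {xs. set xs \<subseteq> {..n} \<and> length xs \<le> n}"
    by (auto simp: partitions_def length_le_sum_list member_le_sum_list)
  show "finite {xs. set xs \<subseteq> {..n} \<and> length xs \<le> n}"
    by (rule finite_lists_length_le) simp
qed

end

theory Submission
  imports Defs
begin

text \<open>Encode a partition with parts \<open>x\<^sub>0 \<ge> \<dots> \<ge> x\<^bsub>k-1\<^esub>\<close> by its beta-set \<open>X = {x\<^sub>i + k - 1 - i}\<close>; the hook
  numbers are the differences \<open>b - y > 0\<close> with \<open>b \<in> X\<close> and \<open>y \<notin> X\<close>. Adding a new largest part whose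
  element of the beta-set is \<open>b\<close> therefore creates \<open>b div t - #{y \<in> X. y \<equiv> b mod t}\<close> hook
  numbers divisible by \<open>t\<close>. Hence, if \<open>h\<close> hook numbers of a partition of \<open>n\<close> are divisible
  by \<open>t\<close>, then \<open>n - t h\<close> depends only on the numbers \<open>k\<^sub>r\<close> of elements of \<open>X\<close> in the residue classes
  mod \<open>t\<close>. For \<open>t = 2\<close> one gets \<open>8 (n - 2 h) + 1 = (2 (k\<^sub>0 - k\<^sub>1) - 1)\<^sup>2\<close>. For \<open>t = 3\<close> the number
  \<open>3 (3 (n - 3 h) + 1)\<close> is a value of the form \<open>u\<^sup>2 + u v + v\<^sup>2\<close>, and a prime \<open>l \<equiv> 2 (mod 3)\<close>
  divides such a value only if it divides \<open>u\<close> and \<open>v\<close>.\<close>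

section \<open>Beta-sets\<close>

primrec beta_set :: "nat list \<Rightarrow> nat set" where
  "beta_set [] = {}"
| "beta_set (x # xs) = insert (x + length xs) (beta_set xs)"

lemma finite_beta_set [simp]: "finite (beta_set xs)"
  by (induction xs) auto

lemma beta_set_less:
  "sorted_wrt (\<ge>) (x # xs) \<Longrightarrow> y \<in> beta_set xs \<Longrightarrow> y < x + length xs"
  by (induction xs arbitrary: x) fastforce+

text \<open>Part \<open>j\<close> of the conjugate partition; applied to the rows below a cell in
  column \<open>j\<close>, it is the leg of that cell.\<close>

definition leg_column :: "nat list \<Rightarrow> nat \<Rightarrow> nat" where
  "leg_column xs j = length (filter (\<lambda>y. j < y) xs)"

lemma leg_column_le: "leg_column xs j \<le> length xs"
  by (simp add: leg_column_def)

lemma leg_column_antimono: "i \<le> j \<Longrightarrow> leg_column xs j \<le> leg_column xs i"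
  unfolding leg_column_def by (induction xs) auto

text \<open>For a partition \<open>xs\<close> these values list the complement of its beta-set in
  increasing order.\<close>

definition beta_gap :: "nat list \<Rightarrow> nat \<Rightarrow> nat" where
  "beta_gap xs j = j + (length xs - leg_column xs j)"

lemma inj_beta_gap: "inj (beta_gap xs)"
proof (rule linorder_injI)
  fix i j :: nat
  assume "i < j"
  then show "beta_gap xs i \<noteq> beta_gap xs j"
    using leg_column_antimono[of i j xs] by (simp add: beta_gap_def)
qed

text \<open>Induction on rows: a new first row \<open>x\<close> keeps the gaps with
  \<open>j < x\<close>, which lie below its element \<open>x + length xs\<close>, and puts all
  others beyond that maximum.\<close>

lemma beta_gap_notin:
  assumes "sorted_wrt (\<ge>) xs"
  shows "beta_gap xs j \<notin> beta_set xs"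
  using assms
proof (induction xs)
  case Nil
  then show ?case by simp
next
  case (Cons x xs)
  show ?case
  proof (cases "j < x")
    case True
    then have "beta_gap (x # xs) j = beta_gap xs j"
      by (simp add: beta_gap_def leg_column_def)
    moreover have "beta_gap xs j < x + length xs"
      using True by (simp add: beta_gap_def)
    ultimately show ?thesis
      using Cons by simp
  next
    case False
    then have "filter (\<lambda>y. j < y) (x # xs) = []"
      using Cons.prems by (auto simp: filter_empty_conv)
    then have "x + length xs < beta_gap (x # xs) j"
      using False by (simp add: beta_gap_def leg_column_def)
    then show ?thesis
      using beta_set_less[OF Cons.prems] by fastforce
  qed
qed

lemma card_beta_set: "sorted_wrt (\<ge>) xs \<Longrightarrow> card (beta_set xs) = length xs"
proof (induction xs)
  case (Cons x xs)
  then have "x + length xs \<notin> beta_set xs"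
    using beta_set_less by blast
  with Cons show ?case by simp
qed simp

text \<open>An injection between sets of equal size: \<open>beta_set xs\<close> takes
  \<open>length xs\<close> of the \<open>x + length xs\<close> numbers and leaves
  \<open>x\<close>.\<close>

lemma bij_betw_beta_gap:
  assumes "sorted_wrt (\<ge>) (x # xs)"
  shows "bij_betw (beta_gap xs) {..<x} ({..<x + length xs} - beta_set xs)"
proof -
  have "beta_gap xs ` {..<x} = {..<x + length xs} - beta_set xs"
  proof (rule card_subset_eq)
    show "beta_gap xs ` {..<x} \<subseteq> {..<x + length xs} - beta_set xs"
      using assms beta_gap_notin by (auto simp: beta_gap_def)
    have "beta_set xs \<subseteq> {..<x + length xs}"
      using beta_set_less[OF assms] by auto
    then show "card (beta_gap xs ` {..<x}) = card ({..<x + length xs} - beta_set xs)"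
      using assms by (simp add: card_Diff_subset card_beta_set card_image inj_on_subset[OF inj_beta_gap])
  qed simp
  then show ?thesis
    by (simp add: bij_betw_def inj_on_subset[OF inj_beta_gap])
qed

section \<open>Hook numbers divisible by t\<close>

lemma young_diagram_Cons:
  "young_diagram (x # xs) = Pair 0 ` {..<x} \<union> map_prod Suc id ` young_diagram xs"
proof (rule Set.set_eqI)
  fix c :: "nat \<times> nat"
  obtain i j where "c = (i, j)" by fastforce
  then show "c \<in> young_diagram (x # xs)
      \<longleftrightarrow> c \<in> Pair 0 ` {..<x} \<union> map_prod Suc id ` young_diagram xs"
    by (cases i) (auto simp: young_diagram_def image_iff)
qed

lemma hook_number_eq:
  assumes "(i, j) \<in> young_diagram xs"
  shows "hook_number xs (i, j) = xs ! i - j + leg_column (drop (Suc i) xs) j"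
proof -
  have "{(i', j') \<in> young_diagram xs. i' = i \<and> j < j'} = Pair i ` {j<..<xs ! i}"
    using assms by (auto simp: young_diagram_def)
  then have arm: "card {(i', j') \<in> young_diagram xs. i' = i \<and> j < j'} = xs ! i - Suc j"
    by (simp add: card_image inj_on_def)
  have "{(i', j') \<in> young_diagram xs. i < i' \<and> j' = j}
      = (\<lambda>m. (Suc i + m, j)) ` {m. m < length (drop (Suc i) xs) \<and> j < drop (Suc i) xs ! m}"
  proof (intro equalityI subsetI)
    fix c assume "c \<in> {(i', j') \<in> young_diagram xs. i < i' \<and> j' = j}"
    then obtain i' where i': "c = (i', j)" "i < i'" "i' < length xs" "j < xs ! i'"
      by (auto simp: young_diagram_def)
    then have "i' - Suc i < length (drop (Suc i) xs)" "Suc i + (i' - Suc i) = i'"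
      by auto
    with i' show "c \<in> (\<lambda>m. (Suc i + m, j)) `
        {m. m < length (drop (Suc i) xs) \<and> j < drop (Suc i) xs ! m}"
      by (intro image_eqI[of _ _ "i' - Suc i"]) auto
  qed (use assms in \<open>auto simp: young_diagram_def\<close>)
  then have leg: "card {(i', j') \<in> young_diagram xs. i < i' \<and> j' = j}
      = leg_column (drop (Suc i) xs) j"
    by (simp add: card_image inj_on_def leg_column_def length_filter_conv_card)
  \<comment> \<open>Subtraction truncates: this bound turns \<open>xs ! i - Suc j + 1\<close> into
    \<open>xs ! i - j\<close>.\<close>
  have "j < xs ! i" using assms by (simp add: young_diagram_def)
  then show ?thesis
    unfolding hook_number_def prod.case arm leg by simp
qed

lemma size_hook_multiset:
  "size (hook_multiset t xs) = card {c \<in> young_diagram xs. t dvd hook_number xs c}"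
  by (simp add: hook_multiset_def filter_mset_image_mset filter_mset_mset_set finite_young_diagram)

text \<open>Together the two sets consist of the natural numbers \<open>b - t\<close>,
  \<open>b - 2 * t\<close>, and so on, split by membership in \<open>X\<close>.\<close>

lemma card_beta_complement_cong:
  fixes t b :: nat
  assumes "t > 0" and "finite X" and "X \<subseteq> {..<b}"
  shows "card {y \<in> {..<b} - X. t dvd b - y} + card {y \<in> X. y mod t = b mod t} = b div t"
proof -
  have "{y \<in> {..<b}. t dvd b - y} = (\<lambda>m. b - t * Suc m) ` {..<b div t}"
  proof (intro equalityI subsetI)
    fix y assume y: "y \<in> {y \<in> {..<b}. t dvd b - y}"
    then obtain m where m: "b - y = t * m" by auto
    with y have "m > 0" by (cases m) auto
    then obtain m' where m': "m = Suc m'" by (cases m) auto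
    have "t * m \<le> b" using m by linarith
    then have "m \<le> b div t"
      using \<open>t > 0\<close> by (simp add: less_eq_div_iff_mult_less_eq mult.commute)
    moreover have "y = b - t * Suc m'" using y m m' by auto
    ultimately show "y \<in> (\<lambda>m. b - t * Suc m) ` {..<b div t}"
      using m' by auto
  next
    fix y assume "y \<in> (\<lambda>m. b - t * Suc m) ` {..<b div t}"
    then obtain m where m: "m < b div t" "y = b - t * Suc m" by auto
    then have "t * Suc m \<le> b"
      using \<open>t > 0\<close> by (metis Suc_leI less_eq_div_iff_mult_less_eq mult.commute)
    moreover from \<open>t > 0\<close> have "0 < t * Suc m" by simp
    ultimately have "b - t * Suc m < b" by linarith
    with \<open>t * Suc m \<le> b\<close> m \<open>t > 0\<close> show "y \<in> {y \<in> {..<b}. t dvd b - y}"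
      by (auto simp del: mult_Suc_right)
  qed
  moreover have "inj_on (\<lambda>m. b - t * Suc m) {..<b div t}"
  proof (rule inj_onI)
    fix m m' assume *: "m \<in> {..<b div t}" "m' \<in> {..<b div t}" "b - t * Suc m = b - t * Suc m'"
    then have "t * Suc m \<le> b" "t * Suc m' \<le> b"
      using \<open>t > 0\<close> by (metis Suc_leI less_eq_div_iff_mult_less_eq mult.commute lessThan_iff)+
    with * have "t * Suc m = t * Suc m'" by linarith
    with \<open>t > 0\<close> show "m = m'" by simp
  qed
  ultimately have "card {y \<in> {..<b}. t dvd b - y} = b div t"
    by (simp add: card_image)
  moreover have "{y \<in> {..<b}. t dvd b - y}
      = {y \<in> {..<b} - X. t dvd b - y} \<union> {y \<in> X. y mod t = b mod t}"
    using assms(3) by (auto simp: mod_eq_dvd_iff_nat less_imp_le eq_commute[of "_ mod _" "b mod t"])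
  moreover have "card ({y \<in> {..<b} - X. t dvd b - y} \<union> {y \<in> X. y mod t = b mod t})
      = card {y \<in> {..<b} - X. t dvd b - y} + card {y \<in> X. y mod t = b mod t}"
    using \<open>finite X\<close> by (intro card_Un_disjoint) auto
  ultimately show ?thesis by simp
qed

text \<open>Lower rows keep their hooks; those of the new row are the differences
  \<open>b - y\<close> with \<open>y < b\<close> outside \<open>beta_set xs\<close>.\<close>

lemma size_hook_multiset_Cons:
  assumes "sorted_wrt (\<ge>) (x # xs)" and "t > 0"
  defines "b \<equiv> x + length xs"
  shows "size (hook_multiset t (x # xs)) + card {y \<in> beta_set xs. y mod t = b mod t}
    = size (hook_multiset t xs) + b div t"
proof -
  let ?Y = "young_diagram (x # xs)" and ?H = "hook_number (x # xs)"
  have row: "?H (0, j) = b - beta_gap xs j" if "j < x" for j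
  proof -
    have "(0, j) \<in> ?Y" using that by (simp add: young_diagram_def)
    with that show ?thesis
      using leg_column_le[of xs j] by (simp add: hook_number_eq b_def beta_gap_def)
  qed
  have rest: "?H (map_prod Suc id c) = hook_number xs c" if "c \<in> young_diagram xs" for c
  proof -
    obtain i j where c: "c = (i, j)" by fastforce
    with that have "(Suc i, j) \<in> ?Y" by (simp add: young_diagram_def)
    with that c show ?thesis by (simp add: hook_number_eq)
  qed
  have "{c \<in> ?Y. t dvd ?H c} = Pair 0 ` {j \<in> {..<x}. t dvd b - beta_gap xs j}
      \<union> map_prod Suc id ` {c \<in> young_diagram xs. t dvd hook_number xs c}"
    using row rest by (auto simp: young_diagram_Cons)
  moreover have "card (Pair (0::nat) ` {j \<in> {..<x}. t dvd b - beta_gap xs j}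
      \<union> map_prod Suc id ` {c \<in> young_diagram xs. t dvd hook_number xs c})
      = card {j \<in> {..<x}. t dvd b - beta_gap xs j}
        + card {c \<in> young_diagram xs. t dvd hook_number xs c}"
    by (subst card_Un_disjoint)
      (auto simp: finite_young_diagram card_image inj_on_def)
  moreover have "card {j \<in> {..<x}. t dvd b - beta_gap xs j}
      = card {y \<in> {..<b} - beta_set xs. t dvd b - y}"
  proof -
    have "bij_betw (beta_gap xs) {j \<in> {..<x}. t dvd b - beta_gap xs j}
        {y \<in> {..<b} - beta_set xs. t dvd b - y}"
      using bij_betw_beta_gap[OF assms(1)] unfolding b_def bij_betw_def
      by (auto simp: inj_on_def)
    then show ?thesis by (rule bij_betw_same_card)
  qed
  moreover have "beta_set xs \<subseteq> {..<b}"
    using beta_set_less[OF assms(1)] by (auto simp: b_def)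
  then have "card {y \<in> {..<b} - beta_set xs. t dvd b - y}
      + card {y \<in> beta_set xs. y mod t = b mod t} = b div t"
    using \<open>t > 0\<close> by (intro card_beta_complement_cong) auto
  ultimately show ?thesis by (simp add: size_hook_multiset)
qed

section \<open>Residue classes of the beta-set and the size of the t-core\<close>

definition beta_count :: "nat \<Rightarrow> nat list \<Rightarrow> nat \<Rightarrow> nat" where
  "beta_count t xs r = card {y \<in> beta_set xs. y mod t = r}"

lemma beta_count_Cons:
  assumes "sorted_wrt (\<ge>) (x # xs)"
  shows "beta_count t (x # xs) r
    = beta_count t xs r + (if r = (x + length xs) mod t then 1 else 0)"
proof -
  have "{y \<in> beta_set (x # xs). y mod t = r} = (if r = (x + length xs) mod t
      then insert (x + length xs) {y \<in> beta_set xs. y mod t = r}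
      else {y \<in> beta_set xs. y mod t = r})"
    by auto
  moreover have "x + length xs \<notin> beta_set xs"
    using beta_set_less[OF assms] by auto
  ultimately show ?thesis by (simp add: beta_count_def)
qed

lemma sum_beta_count:
  assumes "sorted_wrt (\<ge>) xs" and "t > 0"
  shows "(\<Sum>r<t. beta_count t xs r) = length xs"
  using assms
proof (induction xs)
  case (Cons x xs)
  then show ?case by (simp add: beta_count_Cons sum.distrib)
qed (simp add: beta_count_def)

text \<open>Both sides of the equation for \<open>n - t h\<close> are doubled to avoid binomial coefficients.\<close>

lemma twice_core_size:
  assumes "sorted_wrt (\<ge>) xs" and "t > 0"
  shows "2 * (int (sum_list xs) - int t * int (size (hook_multiset t xs)))
    = (\<Sum>r<t. 2 * int r * int (beta_count t xs r)
          + int t * (int (beta_count t xs r) * (int (beta_count t xs r) - 1)))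
      - int (length xs) * (int (length xs) - 1)"
  using assms
proof (induction xs)
  case Nil
  then show ?case
    by (simp add: hook_multiset_def young_diagram_def beta_count_def)
next
  case (Cons x xs)
  define b where "b = x + length xs"
  define s where "s = b mod t"
  define f where "f ys r = 2 * int r * int (beta_count t ys r)
          + int t * (int (beta_count t ys r) * (int (beta_count t ys r) - 1))" for ys r
  \<comment> \<open>Only the class of \<open>b\<close> gains an element, and
    \<open>k * (k - 1)\<close> grows by \<open>2 * k\<close> when \<open>k\<close> becomes
    \<open>k + 1\<close>.\<close>
  have "f (x # xs) r = f xs r + (if r = s then 2 * int s + 2 * int t * int (beta_count t xs s) else 0)"
    for r
    using Cons.prems by (simp add: f_def beta_count_Cons s_def b_def algebra_simps)
  then have "(\<Sum>r<t. f (x # xs) r)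
      = (\<Sum>r<t. f xs r) + (2 * int s + 2 * int t * int (beta_count t xs s))"
    using \<open>t > 0\<close> by (simp add: sum.distrib s_def)
  moreover have "int (size (hook_multiset t (x # xs))) + int (beta_count t xs s)
      = int (size (hook_multiset t xs)) + int (b div t)"
    using size_hook_multiset_Cons[OF Cons.prems]
    by (simp add: beta_count_def s_def b_def flip: of_nat_add)
  then have "int t * int (size (hook_multiset t (x # xs)))
      = int t * int (size (hook_multiset t xs)) + int t * int (b div t)
        - int t * int (beta_count t xs s)"
    by (metis add_diff_cancel_right' distrib_left right_diff_distrib)
  moreover have "int t * int (b div t) + int s = int x + int (length xs)"
    by (simp add: s_def b_def flip: of_nat_mult of_nat_add)
  moreover have "2 * (int (sum_list xs) - int t * int (size (hook_multiset t xs)))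
      = (\<Sum>r<t. f xs r) - int (length xs) * (int (length xs) - 1)"
    using Cons by (simp add: f_def)
  \<comment> \<open>As \<open>x - t * (b div t) = s - length xs\<close>, the left side grows by the
    growth of the sum minus \<open>2 * length xs\<close>, which is the growth of the subtracted
    product.\<close>
  ultimately have "2 * (int (sum_list (x # xs)) - int t * int (size (hook_multiset t (x # xs))))
      = (\<Sum>r<t. f (x # xs) r) - int (length (x # xs)) * (int (length (x # xs)) - 1)"
    by (simp add: algebra_simps)
  then show ?case by (simp only: f_def)
qed

section \<open>Quadratic forms\<close>

text \<open>With \<open>d = ?k 0 - ?k 1\<close>, the number in parentheses is the triangular number
  \<open>d * (d - 1) / 2\<close>.\<close>

lemma two_core_size_square:
  assumes "xs \<in> partitions n"
  obtains m :: int where "8 * (int n - 2 * int (size (hook_multiset 2 xs))) + 1 = m\<^sup>2"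
proof -
  let ?k = "\<lambda>r. int (beta_count 2 xs r)"
  have xs: "sorted_wrt (\<ge>) xs" "sum_list xs = n"
    using assms by (auto simp: partitions_def)
  have "int (length xs) = ?k 0 + ?k 1"
    using sum_beta_count[OF xs(1), of 2] by (simp add: numeral_2_eq_2)
  then have "8 * (int n - 2 * int (size (hook_multiset 2 xs))) + 1 = (2 * (?k 0 - ?k 1) - 1)\<^sup>2"
    using twice_core_size[OF xs(1), of 2] xs(2)
    by (simp add: lessThan_nat_numeral lessThan_Suc power2_eq_square algebra_simps)
  then show ?thesis by (rule that)
qed

lemma three_core_size_form:
  assumes "xs \<in> partitions n"
  obtains u v :: int
  where "3 * (3 * (int n - 3 * int (size (hook_multiset 3 xs))) + 1) = u\<^sup>2 + u * v + v\<^sup>2"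
proof -
  let ?k = "\<lambda>r. int (beta_count 3 xs r)"
  have xs: "sorted_wrt (\<ge>) xs" "sum_list xs = n"
    using assms by (auto simp: partitions_def)
  have "int (length xs) = ?k 0 + ?k 1 + ?k 2"
    using sum_beta_count[OF xs(1), of 3] by (simp add: lessThan_nat_numeral lessThan_Suc)
  then have "2 * (int n - 3 * int (size (hook_multiset 3 xs)))
      = 2 * ((?k 0)\<^sup>2 + (?k 1)\<^sup>2 + (?k 2)\<^sup>2 - ?k 0 * ?k 1 - ?k 0 * ?k 2 - ?k 1 * ?k 2 - ?k 0 + ?k 2)"
    using twice_core_size[OF xs(1), of 3] xs(2)
    by (simp add: lessThan_nat_numeral lessThan_Suc power2_eq_square algebra_simps)
  then have core: "int n - 3 * int (size (hook_multiset 3 xs))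
      = (?k 0)\<^sup>2 + (?k 1)\<^sup>2 + (?k 2)\<^sup>2 - ?k 0 * ?k 1 - ?k 0 * ?k 2 - ?k 1 * ?k 2 - ?k 0 + ?k 2"
    by (simp only: mult_cancel_left) simp
  \<comment> \<open>In \<open>a = ?k 0 - ?k 1\<close> and \<open>b = ?k 1 - ?k 2\<close> the core
    size is \<open>a\<^sup>2 + a * b + b\<^sup>2 - a - b\<close>. Shifting both by 1/3 removes the
    linear terms, and scaling by 3 clears denominators.\<close>
  define u v where "u = 3 * (?k 0 - ?k 1) - 1" and "v = 3 * (?k 1 - ?k 2) - 1"
  have "3 * (3 * (int n - 3 * int (size (hook_multiset 3 xs))) + 1) = u\<^sup>2 + u * v + v\<^sup>2"
    unfolding core u_def v_def by (simp add: power2_eq_square algebra_simps)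
  then show ?thesis by (rule that)
qed

text \<open>Cubing is injective modulo \<open>l\<close> because 3 is coprime to \<open>l - 1\<close>, and
  \<open>u\<^sup>3 - v\<^sup>3 = (u - v) (u\<^sup>2 + u v + v\<^sup>2)\<close>.\<close>

lemma prime_dvd_eisenstein_form:
  fixes u v :: int
  assumes "prime l" and "[l = 2] (mod 3)" and dvd: "int l dvd u\<^sup>2 + u * v + v\<^sup>2"
  shows "int l dvd u"
proof (rule ccontr)
  assume u: "\<not> int l dvd u"
  have pl: "prime (int l)" using \<open>prime l\<close> by simp
  have v: "\<not> int l dvd v"
  proof
    assume "int l dvd v"
    then have "int l dvd u * v + v\<^sup>2" by (simp add: power2_eq_square)
    with dvd have "int l dvd u\<^sup>2" by (metis add.assoc dvd_add_left_iff)
    with u pl show False by (simp add: prime_dvd_power_iff)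
  qed
  define m where "m = l div 3"
  have l: "l - 1 = 3 * m + 1"
    using \<open>[l = 2] (mod 3)\<close> by (simp add: cong_def m_def) presburger
  \<comment> \<open>Written this way, Fermat's theorem recovers \<open>w\<close> modulo
    \<open>l\<close> from its cube.\<close>
  have fermat: "[w * (w ^ 3) ^ m = 1] (mod int l)" if "\<not> int l dvd w" for w
  proof -
    have "residues (int l)"
      using prime_gt_1_nat[OF \<open>prime l\<close>] by (simp add: residues_def)
    moreover have "coprime w (int l)"
      using prime_imp_coprime[OF pl that] by (simp add: coprime_commute)
    ultimately have "[w ^ (l - 1) = 1] (mod int l)"
      using residues.euler_theorem[of "int l" w] \<open>prime l\<close> by (simp add: totient_prime)
    then show ?thesis unfolding l by (simp add: power_mult)
  qed
  have "u ^ 3 - v ^ 3 = (u - v) * (u\<^sup>2 + u * v + v\<^sup>2)"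
    by (simp add: power2_eq_square power3_eq_cube algebra_simps)
  then have cube: "[u ^ 3 = v ^ 3] (mod int l)"
    using dvd by (simp add: cong_iff_dvd_diff)
  have "[u * (v ^ 3) ^ m = u * (u ^ 3) ^ m] (mod int l)"
    by (rule cong_mult[OF cong_refl cong_pow[OF cong_sym[OF cube]]])
  also have "[u * (u ^ 3) ^ m = 1] (mod int l)" using fermat[OF u] .
  also have "[1 = v * (v ^ 3) ^ m] (mod int l)" using fermat[OF v] by (rule cong_sym)
  finally have "int l dvd (u - v) * (v ^ 3) ^ m"
    by (simp add: cong_iff_dvd_diff left_diff_distrib)
  then have uv: "int l dvd u - v"
    using v pl by (metis prime_dvd_mult_iff prime_dvd_power)
  \<comment> \<open>With \<open>u\<close> congruent to \<open>v\<close>, the form is congruent to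
    \<open>3 * u\<^sup>2\<close>, so \<open>l\<close> would have to be 3.\<close>
  have "3 * u\<^sup>2 = (u\<^sup>2 + u * v + v\<^sup>2) + (u - v) * (2 * u + v)"
    by (simp add: power2_eq_square algebra_simps)
  then have "int l dvd 3 * u\<^sup>2" using dvd_add[OF dvd dvd_mult2[OF uv]] by metis
  then have "int l dvd 3"
    using u pl by (auto simp: prime_dvd_mult_iff prime_dvd_power_iff)
  then have "l dvd 3" by presburger
  then have "l = 3"
    using \<open>prime l\<close> by (simp add: primes_dvd_imp_eq)
  with \<open>[l = 2] (mod 3)\<close> show False by (simp add: cong_def)
qed

section \<open>Vanishing of the hook counts\<close>

lemma hook_count_eq_0I:
  assumes "\<And>xs. xs \<in> partitions n \<Longrightarrow> [size (hook_multiset t xs) = a] (mod b) \<Longrightarrow> False"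
  shows "hook_count t a b n = 0"
proof -
  have "{xs \<in> partitions n. [size (hook_multiset t xs) = a] (mod b)} = {}"
    using assms by blast
  then show ?thesis by (simp only: hook_count_def card.empty)
qed

text \<open>A counted partition would make the argument of the Legendre symbol congruent to a square
  modulo \<open>l\<close>.\<close>

lemma hook_count_2_eq_0:
  assumes "Legendre (- 16 * int a1 + 8 * int a2 + 1) (int l) = - 1"
  shows "hook_count 2 a1 l (l * n + a2) = 0"
proof (rule hook_count_eq_0I)
  fix xs
  assume xs: "xs \<in> partitions (l * n + a2)"
    and h: "[size (hook_multiset 2 xs) = a1] (mod l)"
  let ?h = "int (size (hook_multiset 2 xs))"
  obtain m where m: "8 * (int (l * n + a2) - 2 * ?h) + 1 = m\<^sup>2"
    using two_core_size_square[OF xs] .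
  have "[?h = int a1] (mod int l)" using h by (simp add: cong_int_iff)
  then obtain q where "?h = int a1 + int l * q"
    by (metis cong_iff_lin cong_sym)
  then have "m\<^sup>2 - (- 16 * int a1 + 8 * int a2 + 1) = int l * (8 * int n - 16 * q)"
    by (simp flip: m add: algebra_simps)
  then have "[m\<^sup>2 = - 16 * int a1 + 8 * int a2 + 1] (mod int l)"
    by (simp add: cong_iff_dvd_diff)
  then have "QuadRes (int l) (- 16 * int a1 + 8 * int a2 + 1)"
    by (auto simp: QuadRes_def)
  with assms show False by (simp add: Legendre_def split: if_splits)
qed

text \<open>For a counted partition, \<open>3 * ?A\<close> is congruent modulo
  \<open>l\<^sup>2\<close> to a value of the form. If \<open>l\<close> divides this value, so does
  \<open>l\<^sup>2\<close>, which excludes multiplicity 1.\<close>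

lemma hook_count_3_eq_0:
  assumes l: "prime l" "[l = 2] (mod 3)"
    and mult: "multiplicity (int l) (- 9 * int a1 + 3 * int a2 + 1) = 1"
  shows "hook_count 3 a1 (l\<^sup>2) (l\<^sup>2 * n + a2) = 0"
proof (rule hook_count_eq_0I)
  fix xs
  assume xs: "xs \<in> partitions (l\<^sup>2 * n + a2)"
    and h: "[size (hook_multiset 3 xs) = a1] (mod l\<^sup>2)"
  let ?h = "int (size (hook_multiset 3 xs))" and ?A = "- 9 * int a1 + 3 * int a2 + 1"
  obtain u v where uv: "3 * (3 * (int (l\<^sup>2 * n + a2) - 3 * ?h) + 1) = u\<^sup>2 + u * v + v\<^sup>2"
    using three_core_size_form[OF xs] .
  have "[?h = int a1] (mod int (l\<^sup>2))" using h by (simp only: cong_int_iff)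
  then obtain q where "?h = int a1 + int (l\<^sup>2) * q"
    by (metis cong_iff_lin cong_sym)
  then have A: "u\<^sup>2 + u * v + v\<^sup>2 = 3 * ?A + (int l)\<^sup>2 * (9 * int n - 27 * q)"
    unfolding uv[symmetric] by (simp add: algebra_simps)
  have "int l dvd ?A"
    using multiplicity_dvd[of "int l" ?A] mult by simp
  then have dvd: "int l dvd u\<^sup>2 + u * v + v\<^sup>2"
    unfolding A by (metis dvd_add dvd_mult dvd_mult2 dvd_triv_left power2_eq_square)
  then have "int l dvd u" "int l dvd v"
    using prime_dvd_eisenstein_form[OF l, of u v] prime_dvd_eisenstein_form[OF l, of v u]
    by (simp_all add: ac_simps)
  then have "(int l)\<^sup>2 dvd u\<^sup>2 + u * v + v\<^sup>2"
    by (simp add: power2_eq_square mult_dvd_mono)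
  then have "(int l)\<^sup>2 dvd 3 * ?A"
    unfolding A by (simp only: dvd_add_left_iff dvd_triv_left)
  moreover have "coprime ((int l)\<^sup>2) 3"
  proof -
    have "l \<noteq> 3" using l(2) by (auto simp: cong_def)
    then have "coprime l 3" using l(1) by (simp add: primes_coprime)
    then have "coprime (int l) (int 3)" by (simp only: coprime_int_iff)
    then show ?thesis by simp
  qed
  ultimately have "(int l)\<^sup>2 dvd ?A"
    by (simp only: coprime_dvd_mult_right_iff)
  \<comment> \<open>The multiplicity of 0 is 0 by convention, so \<open>mult\<close> excludes this
    case.\<close>
  moreover have "?A \<noteq> 0" using mult by auto
  ultimately have "2 \<le> multiplicity (int l) ?A"
    using l(1) by (intro multiplicity_geI) (auto dest: prime_gt_1_nat)
  with mult show False by simp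
qed

theorem theorem1p16:
  shows "(\<forall>l a1 a2 :: nat.
            prime l \<and> odd l \<and> a1 < l \<and> a2 < l \<and>
            Legendre (- 16 * int a1 + 8 * int a2 + 1) (int l) = - 1
            \<longrightarrow> (\<forall>n :: nat. hook_count 2 a1 l (l * n + a2) = 0))
       \<and> (\<forall>l a1 a2 :: nat.
            prime l \<and> [l = 2] (mod 3) \<and> a1 < l ^ 2 \<and> a2 < l ^ 2 \<and>
            multiplicity (int l) (- 9 * int a1 + 3 * int a2 + 1) = 1
            \<longrightarrow> (\<forall>n :: nat. hook_count 3 a1 (l ^ 2) (l ^ 2 * n + a2) = 0))"
  using hook_count_2_eq_0 hook_count_3_eq_0 by blast

end
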